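(* Let $h,\tau\in(0,1)$ with $T/\tau\in\mathbb{N}$, and let $\nu_h\ge 0$ be such that for each $i=1,\dots,d$ $$\nu_h+\Sigma_i(t,x)\ge h\,|f_i(t,x,a,b)|\ \text{ for all }(t,x,a,b),\qquad d\,\nu_h+\sup_{(t,x)\in\Omega^{\tau,h}_T}\sum_{i=1}^d\Sigma_i(t,x)\le \frac{h^2}{\tau},$$ and such that $$d\tau\Big(\max_{i=1,\dots,d}\|\Sigma_i\|_\infty\Big)\le 4h^2,\qquad 96\,\tau\max\{\|c\|_\infty^2,\,2d\|f\|_\infty^2\}\le \min_{i=1,\dots,d}\inf_{(t,x)}\Sigma_i(t,x)+\nu_h .$$ Let $\Lambda^h>\lambda^h\ge\nu_h$ be such that $0<\lambda^h\le \Sigma_i+\nu_h\le\Lambda^h$ for each $i\in\{1,\dots,d\}$. Let $V^{\tau,h}$ be the solution of the discrete equation and $(V^{\tau,h}_n,\alpha_n,\beta_n)_{n\ge0}$ the policy iteration described in the context. Then, for all $n\in\mathbb{N}=\{1,2,\dots\}$ and $i=1,\dots,d$, $$\sup_{(t,x)\in\Omega^{\tau,h}_T}\big|D_i^h(V_n^{\tau,h}(t,x)-V^{\tau,h}(t,x))\big|^2\le C_h\,h^{-2}\,2^{1-n},$$ $$\sup_{(t,x)\in\Omega^{\tau,h}_T}\big|L(t,x,\nabla^hV^{\tau,h})(\alpha_n,\beta_n)-H(t,x,\nabla^hV^{\tau,h})\big|^2\le 16\,d\,C_h\,\|f\|_\infty^2\,h^{-2}\,2^{1-n},$$ where $C_h=e^{C_1T/\lambda^h}\big(12\|g\|_\infty^2+T\lambda^h\big)$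 and $C_1=48\max\{\|c\|_\infty^2,\,2d\|f\|_\infty^2\}$.
   Context: Fix $T>0$, $d,m_\alpha,m_\beta\in\mathbb{N}$ and compact sets $A\subseteq\mathbb{R}^{m_\alpha}$, $B\subseteq\mathbb{R}^{m_\beta}$. Let $c:[0,T]\times\mathbb{R}^d\times A\times B\to\mathbb{R}$, $f=(f_1,\dots,f_d):[0,T]\times\mathbb{R}^d\times A\times B\to\mathbb{R}^d$, $g:\mathbb{R}^d\to\mathbb{R}$ and $\sigma=\mathrm{diag}(\sigma_1,\dots,\sigma_d):[0,T]\times\mathbb{R}^d\to\mathbb{R}^{d\times d}$ be uniformly bounded, and $\Sigma_i:=\sigma_i^2$. $\|\cdot\|_\infty$ is the supremum norm (of the Euclidean norm for vector-valued functions). Set $L(t,x,p)(a,b):=c(t,x,a,b)+p\cdot f(t,x,a,b)$ and $H(t,x,p):=\sup_{b\in B}\inf_{a\in A}L(t,x,p)(a,b)$. It is assumed throughout that for all $(t,x)$ (in the grid), $p$ and $b$ there is a minimizer $\alpha_b(t,x,p)\in\arg\min_{a\in A}L(t,x,p)(a,b)$ and that, for one fixed selection $\alpha_b$, $\arg\max_{b\in B}L(t,x,p)(\alpha_b(t,x,p),b)$ is nonempty. No uniqueness or regularity of these selections is assumed. Grid: $\mathbb{N}^\tau_T:=\{0,\tau,2\tau,\dots,T\}$, $\mathbb{Z}^d_h:=h\mathbb{Z}^d$, $\Omega^{\tau,h}_T:=\mathbb{N}^\tau_T\times\mathbb{Z}^d_h$. Difference operators ($e_i$ the standard basis): $\partial_t^\tau\varphi(t,x):=\frac{\varphi(t,x)-\varphi(t-\tau,x)}{\tau}$;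 $D_i^h\varphi(t,x):=\frac{\varphi(t,x+he_i)-\varphi(t,x)}{h}$; $\nabla^h\varphi(t,x):=\big(\frac{\varphi(t,x+he_i)-\varphi(t,x-he_i)}{2h}\big)_{1\le i\le d}$; $\Delta_i^h\varphi(t,x):=\frac{\varphi(t,x+he_i)-2\varphi(t,x)+\varphi(t,x-he_i)}{h^2}$. Equations containing $\partial^\tau_t$ are imposed at the grid points with $t\in\{\tau,2\tau,\dots,T\}$; they are explicit schemes solved backwards from $t=T$. $V^{\tau,h}:\Omega^{\tau,h}_T\to\mathbb{R}$ solves $$\partial_t^\tau V^{\tau,h}+H(t,x,\nabla^hV^{\tau,h})=-\tfrac12\sum_{i=1}^d(\Sigma_i(t,x)+\nu_h)\Delta_i^hV^{\tau,h},\qquad V^{\tau,h}(T,\cdot)=g\ \text{on }\mathbb{Z}^d_h.$$ Policy iteration: given Lipschitz continuous functions $\alpha_0=\alpha_0(t,x)\in A$, $\beta_0=\beta_0(t,x)\in B$, for $n=0,1,\dots$ let $V_n^{\tau,h}:\Omega^{\tau,h}_T\to\mathbb{R}$ solve $$\partial_t^\tau V_n^{\tau,h}+L(t,x,\nabla^hV_n^{\tau,h})(\alpha_n,\beta_n)=-\tfrac12\sum_{i=1}^d(\Sigma_i(t,x)+\nu_h)\Delta_i^hV_n^{\tau,h},\qquad V_n^{\tau,h}(T,\cdot)=g\ \text{on }\mathbb{Z}^d_h,$$ and then, for $(t,x)\in\Omega^{\tau,h}_T$, choose (any selection) $\alpha_{n+1,b}(t,x)\in\arg\min_{a\in A}L(t,x,\nabla^hV_n^{\tau,h}(t,x))(a,b)$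 for each $b\in B$, $\beta_{n+1}(t,x)\in\arg\max_{b\in B}L(t,x,\nabla^hV_n^{\tau,h}(t,x))(\alpha_{n+1,b}(t,x),b)$, and $\alpha_{n+1}(t,x):=\alpha_{n+1,\beta_{n+1}(t,x)}(t,x)$. *)

theory Defs
  imports "HOL-Analysis.Analysis"
begin

text \<open>
  Functions on \<open>[0,T] \<times> \<real>\<^sup>d\<close>, on \<open>[0,T] \<times> \<real>\<^sup>d \<times> A \<times> B\<close> and on the grid are total functions here; only
  their values on the set in question are ever constrained or used.
\<close>

definition sup_norm :: "'a set \<Rightarrow> ('a \<Rightarrow> 'b::real_normed_vector) \<Rightarrow> real" where
  "sup_norm D u = (SUP z\<in>D. norm (u z))"

definition time_grid :: "real \<Rightarrow> real \<Rightarrow> real set" where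
  "time_grid T \<tau> = {real k * \<tau> | k::nat. real k * \<tau> \<le> T}"

definition space_grid :: "real \<Rightarrow> (real^'d) set" where
  "space_grid h = {x. \<forall>i. \<exists>k::int. x $ i = h * real_of_int k}"

definition grid :: "real \<Rightarrow> real \<Rightarrow> real \<Rightarrow> (real \<times> (real^'d)) set" where
  "grid T \<tau> h = time_grid T \<tau> \<times> space_grid h"

definition dt :: "real \<Rightarrow> (real \<Rightarrow> real^'d \<Rightarrow> real) \<Rightarrow> real \<Rightarrow> real^'d \<Rightarrow> real" where
  "dt \<tau> \<phi> t x = (\<phi> t x - \<phi> (t - \<tau>) x) / \<tau>"

definition fdiff :: "real \<Rightarrow> 'd \<Rightarrow> (real \<Rightarrow> real^'d \<Rightarrow> real) \<Rightarrow> real \<Rightarrow> real^'d \<Rightarrow> real" where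
  "fdiff h i \<phi> t x = (\<phi> t (x + h *\<^sub>R axis i 1) - \<phi> t x) / h"

definition dgrad :: "real \<Rightarrow> (real \<Rightarrow> real^'d \<Rightarrow> real) \<Rightarrow> real \<Rightarrow> real^'d \<Rightarrow> real^'d" where
  "dgrad h \<phi> t x =
     (\<chi> i. (\<phi> t (x + h *\<^sub>R axis i 1) - \<phi> t (x - h *\<^sub>R axis i 1)) / (2 * h))"

definition dlap :: "real \<Rightarrow> 'd \<Rightarrow> (real \<Rightarrow> real^'d \<Rightarrow> real) \<Rightarrow> real \<Rightarrow> real^'d \<Rightarrow> real" where
  "dlap h i \<phi> t x =
     (\<phi> t (x + h *\<^sub>R axis i 1) - 2 * \<phi> t x + \<phi> t (x - h *\<^sub>R axis i 1)) / h\<^sup>2"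

definition Sig :: "(real \<Rightarrow> real^'d \<Rightarrow> real^'d^'d) \<Rightarrow> 'd \<Rightarrow> real \<Rightarrow> real^'d \<Rightarrow> real" where
  "Sig \<sigma> i t x = (\<sigma> t x $ i $ i)\<^sup>2"

definition Lag ::
  "(real \<Rightarrow> real^'d \<Rightarrow> 'a \<Rightarrow> 'b \<Rightarrow> real) \<Rightarrow> (real \<Rightarrow> real^'d \<Rightarrow> 'a \<Rightarrow> 'b \<Rightarrow> real^'d)
   \<Rightarrow> real \<Rightarrow> real^'d \<Rightarrow> real^'d \<Rightarrow> 'a \<Rightarrow> 'b \<Rightarrow> real" where
  "Lag c f t x p a b = c t x a b + p \<bullet> f t x a b"

definition Ham ::
  "'a set \<Rightarrow> 'b set
   \<Rightarrow> (real \<Rightarrow> real^'d \<Rightarrow> 'a \<Rightarrow> 'b \<Rightarrow> real) \<Rightarrow> (real \<Rightarrow> real^'d \<Rightarrow> 'a \<Rightarrow> 'b \<Rightarrow> real^'d)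
   \<Rightarrow> real \<Rightarrow> real^'d \<Rightarrow> real^'d \<Rightarrow> real" where
  "Ham A B c f t x p = (SUP b\<in>B. INF a\<in>A. Lag c f t x p a b)"

text \<open>
  The explicit backward scheme with a generic first-order term \<open>F t x p\<close>. The equation is imposed at
  the positive grid times, so that it determines \<open>V\<close> at time \<open>t - \<tau>\<close> from \<open>V\<close> at time \<open>t\<close>.
\<close>

definition solves_scheme ::
  "real \<Rightarrow> real \<Rightarrow> real \<Rightarrow> real \<Rightarrow> (real \<Rightarrow> real^'d \<Rightarrow> real^'d^'d)
   \<Rightarrow> (real^'d \<Rightarrow> real) \<Rightarrow> (real \<Rightarrow> real^'d \<Rightarrow> real^'d \<Rightarrow> real)
   \<Rightarrow> (real \<Rightarrow> real^'d \<Rightarrow> real) \<Rightarrow> bool" where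
  "solves_scheme T \<tau> h \<nu> \<sigma> g F V \<longleftrightarrow>
     (\<forall>t \<in> time_grid T \<tau> - {0}. \<forall>x \<in> space_grid h.
        dt \<tau> V t x + F t x (dgrad h V t x)
          = - (1/2) * (\<Sum>i\<in>UNIV. (Sig \<sigma> i t x + \<nu>) * dlap h i V t x)) \<and>
     (\<forall>x \<in> space_grid h. V T x = g x)"

text \<open>
  \<open>a'\<close> and \<open>b'\<close> are obtained from \<open>W\<close> by a policy improvement step on the grid; \<open>r b\<close> is the selected
  minimizing response to \<open>b\<close>.
\<close>

definition improved_policy ::
  "real \<Rightarrow> real \<Rightarrow> real \<Rightarrow> 'a set \<Rightarrow> 'b set
   \<Rightarrow> (real \<Rightarrow> real^'d \<Rightarrow> 'a \<Rightarrow> 'b \<Rightarrow> real) \<Rightarrow> (real \<Rightarrow> real^'d \<Rightarrow> 'a \<Rightarrow> 'b \<Rightarrow> real^'d)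
   \<Rightarrow> (real \<Rightarrow> real^'d \<Rightarrow> real)
   \<Rightarrow> ('b \<Rightarrow> real \<Rightarrow> real^'d \<Rightarrow> 'a) \<Rightarrow> (real \<Rightarrow> real^'d \<Rightarrow> 'a) \<Rightarrow> (real \<Rightarrow> real^'d \<Rightarrow> 'b) \<Rightarrow> bool" where
  "improved_policy T \<tau> h A B c f W r a' b' \<longleftrightarrow>
     (\<forall>(t, x) \<in> grid T \<tau> h.
        (\<forall>b\<in>B. is_arg_min (\<lambda>a. Lag c f t x (dgrad h W t x) a b) (\<lambda>a. a \<in> A) (r b t x)) \<and>
        is_arg_max (\<lambda>b. Lag c f t x (dgrad h W t x) (r b t x) b) (\<lambda>b. b \<in> B) (b' t x) \<and>
        a' t x = r (b' t x) t x)"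

end

theory Submission
  imports Defs
begin

text \<open>
  Let \<open>W\<^sub>n = V\<^sub>n - V\<close>. Every estimate below is a bound on \<open>W\<^sub>n\<close> itself: dividing by \<open>h\<close> turns a bound on
  the supremum of \<open>W\<^sub>n\<close> into one on its difference quotients, so it is enough that \<open>2\<^sup>n W\<^sub>n\<^sup>2\<close> is bounded
  uniformly in \<open>n\<close>.

  All equations share the same diffusion, and one backward time step reads \<open>u(t - \<tau>) = M u(t) + \<tau> q\<close>, where
  \<open>M\<close> averages over the neighbouring grid points (\<open>diff_avg\<close>) and \<open>q\<close> is the first-order term. Three
  facts carry the proof.

  \<^item> The average \<open>M\<close> dissipates. The variance of \<open>u\<close> under the averaging weights is at least the mean square
    of its odd part, which consists of the centred differences, so \<open>M(u\<^sup>2) - (M u)\<^sup>2 \<ge> \<tau> \<lambda> \<bar>\<nabla>u\<bar>\<^sup>2\<close> (\<open>jensen_gap\<close>). This gain absorbs the first-order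
    term at the price of a factor \<open>1 + C \<tau> / \<lambda>\<close> per step (\<open>energy_step\<close>).

  \<^item> Policy improvement makes the error of one iterate a source for the next. The updated policy realises the
    Hamiltonian at \<open>\<nabla>V\<^sub>n\<^sub>-\<^sub>1\<close> (\<open>Ham_eq_policy_value\<close>), and both the Lagrangian and the Hamiltonian are Lipschitz
    in the gradient with constant \<open>F\<close>, the bound on \<open>f\<close> (\<open>Ham_lipschitz\<close>). Hence \<open>W\<^sub>n\<close> solves the scheme
    with a first-order term of size at most \<open>F \<bar>\<nabla>W\<^sub>n\<bar> + 2 F \<bar>\<nabla>W\<^sub>n\<^sub>-\<^sub>1\<bar>\<close>.

  \<^item> With \<open>C = 48 max {K\<^sup>2, 2 d F\<^sup>2}\<close>, where \<open>K\<close> bounds \<open>c\<close>, the gradient of \<open>W\<^sub>n\<^sub>-\<^sub>1\<close> enters the estimate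
    for \<open>W\<^sub>n\<^sup>2\<close> with weight \<open>1 / 12\<close>, whereas the estimate for \<open>W\<^sub>n\<^sub>-\<^sub>1\<^sup>2\<close> gains that same gradient with weight
    close to \<open>1\<close>. So even after multiplication by \<open>2\<^sup>n\<close> the gains outweigh the losses in the single energy
    \<open>V\<^sup>2 + V\<^sub>0\<^sup>2 + \<Sum>\<^sub>n 2\<^sup>n W\<^sub>n\<^sup>2\<close> (\<open>total_energy_step\<close>). The maximum principle for \<open>M\<close> then propagates
    its terminal bound \<open>2 \<bar>g\<bar>\<^sup>2\<close> back in time (\<open>backward_growth_bound\<close>), with a constant independent of
    the number of iterates in the sum.
\<close>

section \<open>The averaging operator of the explicit scheme\<close>

text \<open>
  What one explicit backward step does to \<open>\<phi>\<close> at time \<open>t\<close> when the first-order term is absent.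
\<close>

definition diff_avg ::
  "real \<Rightarrow> real \<Rightarrow> ('d::finite \<Rightarrow> real) \<Rightarrow> (real \<Rightarrow> real^'d \<Rightarrow> real) \<Rightarrow> real \<Rightarrow> real^'d \<Rightarrow> real" where
  "diff_avg \<tau> h a \<phi> t x = \<phi> t x + \<tau> / 2 * (\<Sum>i\<in>UNIV. a i * dlap h i \<phi> t x)"

text \<open>
  The centre has weight \<open>1 - \<tau> / h\<^sup>2 * (\<Sum>i. a i)\<close>, so the condition \<open>(\<Sum>i. a i) \<le> h\<^sup>2 / \<tau>\<close> with
  \<open>a\<close> nonnegative is what makes this an average and gives the maximum principle \<open>diff_avg_le\<close>.
\<close>

lemma diff_avg_weights:
  assumes "h \<noteq> 0"
  shows "diff_avg \<tau> h a \<phi> t x = (1 - (\<Sum>i\<in>UNIV. \<tau> * a i / h\<^sup>2)) * \<phi> t x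
    + (\<Sum>i\<in>UNIV. \<tau> * a i / h\<^sup>2 * ((\<phi> t (x + h *\<^sub>R axis i 1) + \<phi> t (x - h *\<^sub>R axis i 1)) / 2))"
proof -
  have "\<tau> / 2 * (\<Sum>i\<in>UNIV. a i * dlap h i \<phi> t x) =
    (\<Sum>i\<in>UNIV. \<tau> * a i / h\<^sup>2 * ((\<phi> t (x + h *\<^sub>R axis i 1) + \<phi> t (x - h *\<^sub>R axis i 1)) / 2)
       - \<tau> * a i / h\<^sup>2 * \<phi> t x)"
    unfolding sum_distrib_left
    by (rule sum.cong) (use assms in \<open>auto simp: dlap_def field_simps\<close>)
  also have "\<dots> = (\<Sum>i\<in>UNIV. \<tau> * a i / h\<^sup>2 * ((\<phi> t (x + h *\<^sub>R axis i 1) + \<phi> t (x - h *\<^sub>R axis i 1)) / 2))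
       - (\<Sum>i\<in>UNIV. \<tau> * a i / h\<^sup>2) * \<phi> t x"
    by (simp only: sum_subtractf sum_distrib_right)
  finally show ?thesis
    unfolding diff_avg_def by (simp add: left_diff_distrib)
qed

lemma space_grid_shift:
  assumes "x \<in> space_grid h"
  shows "x + h *\<^sub>R axis i 1 \<in> space_grid h" "x - h *\<^sub>R axis i 1 \<in> space_grid h"
proof -
  have "\<exists>k::int. (x + h *\<^sub>R axis i 1) $ j = h * real_of_int k" 
       "\<exists>k::int. (x - h *\<^sub>R axis i 1) $ j = h * real_of_int k" for j
  proof -
    obtain k :: int where k: "x $ j = h * real_of_int k"
      using assms unfolding space_grid_def by blast
    show "\<exists>k::int. (x + h *\<^sub>R axis i 1) $ j = h * real_of_int k"
      by (rule exI[of _ "if i = j then k + 1 else k"]) (auto simp: k axis_def algebra_simps)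
    show "\<exists>k::int. (x - h *\<^sub>R axis i 1) $ j = h * real_of_int k"
      by (rule exI[of _ "if i = j then k - 1 else k"]) (auto simp: k axis_def algebra_simps)
  qed
  then show "x + h *\<^sub>R axis i 1 \<in> space_grid h" "x - h *\<^sub>R axis i 1 \<in> space_grid h"
    unfolding space_grid_def by blast+
qed

lemma diff_avg_le:
  fixes \<phi> :: "real \<Rightarrow> real^'d \<Rightarrow> real"
  assumes "0 < \<tau>" "0 < h" and a: "\<And>i. 0 \<le> a i" "(\<Sum>i\<in>UNIV. a i) \<le> h\<^sup>2 / \<tau>"
    and x: "x \<in> space_grid h" and le: "\<And>y. y \<in> space_grid h \<Longrightarrow> \<phi> t y \<le> M"
  shows "diff_avg \<tau> h a \<phi> t x \<le> M"
proof -
  define w where "w i = \<tau> * a i / h\<^sup>2" for i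
  have w0: "0 \<le> w i" for i using assms by (simp add: w_def)
  have w1: "(\<Sum>i\<in>UNIV. w i) \<le> 1"
    using assms by (simp add: w_def field_simps flip: sum_distrib_left sum_divide_distrib)
  have "diff_avg \<tau> h a \<phi> t x = (1 - (\<Sum>i\<in>UNIV. w i)) * \<phi> t x
    + (\<Sum>i\<in>UNIV. w i * ((\<phi> t (x + h *\<^sub>R axis i 1) + \<phi> t (x - h *\<^sub>R axis i 1)) / 2))"
    using diff_avg_weights[of h] assms by (simp add: w_def)
  also have "\<dots> \<le> (1 - (\<Sum>i\<in>UNIV. w i)) * M + (\<Sum>i\<in>UNIV. w i * M)"
  proof (intro add_mono sum_mono mult_left_mono w0)
    fix i
    show "(\<phi> t (x + h *\<^sub>R axis i 1) + \<phi> t (x - h *\<^sub>R axis i 1)) / 2 \<le> M"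
      using le[OF space_grid_shift(1)[OF x, of i]] le[OF space_grid_shift(2)[OF x, of i]] by simp
  qed (use w1 le x in auto)
  also have "\<dots> = M" by (simp add: algebra_simps sum_distrib_left)
  finally show ?thesis .
qed

lemma diff_avg_add:
  "diff_avg \<tau> h a (\<lambda>t x. \<phi> t x + \<psi> t x) t x = diff_avg \<tau> h a \<phi> t x + diff_avg \<tau> h a \<psi> t x"
proof -
  have "dlap h i (\<lambda>t x. \<phi> t x + \<psi> t x) t x = dlap h i \<phi> t x + dlap h i \<psi> t x" for i
    by (simp add: dlap_def add_divide_distrib diff_divide_distrib)
  then show ?thesis by (simp add: diff_avg_def algebra_simps sum.distrib)
qed

lemma diff_avg_scale:
  "diff_avg \<tau> h a (\<lambda>t x. k * \<phi> t x) t x = k * diff_avg \<tau> h a \<phi> t x"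
proof -
  have "dlap h i (\<lambda>t x. k * \<phi> t x) t x = k * dlap h i \<phi> t x" for i
    by (simp add: dlap_def algebra_simps diff_divide_distrib add_divide_distrib)
  then show ?thesis by (simp add: diff_avg_def algebra_simps sum_distrib_left)
qed

lemma diff_avg_minus:
  "diff_avg \<tau> h a (\<lambda>t x. \<phi> t x - \<psi> t x) t x = diff_avg \<tau> h a \<phi> t x - diff_avg \<tau> h a \<psi> t x"
  using diff_avg_add[of \<tau> h a \<phi> "\<lambda>t x. (-1) * \<psi> t x"]
  unfolding diff_avg_scale by simp

lemma diff_avg_sum:
  "finite I \<Longrightarrow> diff_avg \<tau> h a (\<lambda>t x. \<Sum>n\<in>I. \<phi> n t x) t x = (\<Sum>n\<in>I. diff_avg \<tau> h a (\<phi> n) t x)"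
proof (induction rule: finite_induct)
  case empty
  show ?case by (simp add: diff_avg_def dlap_def)
next
  case (insert n I)
  then show ?case by (simp add: diff_avg_add)
qed

lemma dgrad_minus:
  "dgrad h (\<lambda>s y. \<phi> s y - \<psi> s y) t x = dgrad h \<phi> t x - dgrad h \<psi> t x"
  by (simp add: dgrad_def vec_eq_iff flip: diff_divide_distrib)

lemma norm_dgrad_le:
  fixes \<phi> :: "real \<Rightarrow> real^'d \<Rightarrow> real"
  assumes "0 < h" and x: "x \<in> space_grid h" and le: "\<And>y. y \<in> space_grid h \<Longrightarrow> (\<phi> t y)\<^sup>2 \<le> M"
  shows "(norm (dgrad h \<phi> t x))\<^sup>2 \<le> real CARD('d) * M / h\<^sup>2"
proof -
  have "(dgrad h \<phi> t x $ i)\<^sup>2 \<le> M / h\<^sup>2" for i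
  proof -
    let ?u = "\<phi> t (x + h *\<^sub>R axis i 1)" and ?v = "\<phi> t (x - h *\<^sub>R axis i 1)"
    have "(?u - ?v)\<^sup>2 \<le> 4 * M"
      using le[OF space_grid_shift(1)[OF x, of i]] le[OF space_grid_shift(2)[OF x, of i]]
        zero_le_power2[of "?u + ?v"] by (simp add: power2_eq_square algebra_simps)
    then have "(?u - ?v)\<^sup>2 / 4 / h\<^sup>2 \<le> M / h\<^sup>2" by (intro divide_right_mono) auto
    then show ?thesis by (simp add: dgrad_def power_divide power_mult_distrib)
  qed
  then have "(\<Sum>i\<in>UNIV. (dgrad h \<phi> t x $ i)\<^sup>2) \<le> (\<Sum>i\<in>(UNIV::'d set). M / h\<^sup>2)"
    by (intro sum_mono)
  then show ?thesis
    by (simp add: norm_vec_def L2_set_def sum_nonneg)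
qed

text \<open>
  The reflection of \<open>x + h *\<^sub>R axis i 1\<close> to \<open>x - h *\<^sub>R axis i 1\<close> preserves the averaging weights, so \<open>\<phi>\<close> splits
  into an even part \<open>e\<close> and an odd part \<open>\<delta>\<close> that do not interact: the odd part has average zero, and
  Jensen's inequality is needed for the even part only. What remains is the mean square of the odd part,
  whose values are \<open>h\<close> times the components of the centred gradient.
\<close>

lemma jensen_gap:
  fixes \<phi> :: "real \<Rightarrow> real^'d \<Rightarrow> real"
  assumes "0 < \<tau>" "0 < h" and a: "\<And>i. 0 \<le> a i" "(\<Sum>i\<in>UNIV. a i) \<le> h\<^sup>2 / \<tau>"
  shows "(diff_avg \<tau> h a \<phi> t x)\<^sup>2 + \<tau> * (\<Sum>i\<in>UNIV. a i * (dgrad h \<phi> t x $ i)\<^sup>2)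
    \<le> diff_avg \<tau> h a (\<lambda>t x. (\<phi> t x)\<^sup>2) t x"
proof -
  define w where "w i = \<tau> * a i / h\<^sup>2" for i
  define e where "e i = (\<phi> t (x + h *\<^sub>R axis i 1) + \<phi> t (x - h *\<^sub>R axis i 1)) / 2" for i
  define \<delta> where "\<delta> i = (\<phi> t (x + h *\<^sub>R axis i 1) - \<phi> t (x - h *\<^sub>R axis i 1)) / 2" for i
  define s where "s = (\<Sum>i\<in>UNIV. w i)"
  define m where "m = diff_avg \<tau> h a \<phi> t x"
  have w0: "0 \<le> w i" for i using assms by (simp add: w_def)
  have s1: "s \<le> 1"
    using assms by (simp add: s_def w_def field_simps flip: sum_distrib_left sum_divide_distrib)
  have m: "m = (1 - s) * \<phi> t x + (\<Sum>i\<in>UNIV. w i * e i)"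
    using diff_avg_weights[of h] assms by (simp add: m_def s_def w_def e_def)
  have "((\<phi> t (x + h *\<^sub>R axis i 1))\<^sup>2 + (\<phi> t (x - h *\<^sub>R axis i 1))\<^sup>2) / 2 = (e i)\<^sup>2 + (\<delta> i)\<^sup>2" for i
    by (simp add: e_def \<delta>_def power2_eq_square field_simps)
  then have sq: "diff_avg \<tau> h a (\<lambda>t x. (\<phi> t x)\<^sup>2) t x
      = (1 - s) * (\<phi> t x)\<^sup>2 + (\<Sum>i\<in>UNIV. w i * (e i)\<^sup>2) + (\<Sum>i\<in>UNIV. w i * (\<delta> i)\<^sup>2)"
    using diff_avg_weights[of h \<tau> a "\<lambda>t x. (\<phi> t x)\<^sup>2" t x] assms(2)
    by (simp add: distrib_left add_divide_distrib sum.distrib flip: s_def w_def)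
  have "\<tau> * (a i * (dgrad h \<phi> t x $ i)\<^sup>2) = w i * (\<delta> i)\<^sup>2" for i
    using assms by (simp add: w_def \<delta>_def dgrad_def power2_eq_square field_simps)
  then have odd: "\<tau> * (\<Sum>i\<in>UNIV. a i * (dgrad h \<phi> t x $ i)\<^sup>2) = (\<Sum>i\<in>UNIV. w i * (\<delta> i)\<^sup>2)"
    by (simp add: sum_distrib_left)
  \<comment> \<open>Jensen for the even part: its variance around the mean \<open>m\<close> is nonnegative.\<close>
  have "0 \<le> (1 - s) * (\<phi> t x - m)\<^sup>2 + (\<Sum>i\<in>UNIV. w i * (e i - m)\<^sup>2)"
    using s1 w0 by (intro add_nonneg_nonneg sum_nonneg mult_nonneg_nonneg) auto
  also have "(\<Sum>i\<in>UNIV. w i * (e i - m)\<^sup>2) = 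
      (\<Sum>i\<in>UNIV. w i * (e i)\<^sup>2) - 2 * m * (\<Sum>i\<in>UNIV. w i * e i) + m\<^sup>2 * s"
    by (simp add: s_def power2_diff algebra_simps sum.distrib sum_subtractf sum_distrib_left sum_distrib_right)
  also have "(\<Sum>i\<in>UNIV. w i * e i) = m - (1 - s) * \<phi> t x" using m by simp
  finally have "m\<^sup>2 \<le> (1 - s) * (\<phi> t x)\<^sup>2 + (\<Sum>i\<in>UNIV. w i * (e i)\<^sup>2)"
    by (simp add: power2_eq_square algebra_simps)
  then show ?thesis using sq odd by (simp add: m_def)
qed

section \<open>Energy estimates\<close>

text \<open>
  Young's inequality \<open>(m + v)\<^sup>2 \<le> (1 + \<epsilon>) (m\<^sup>2 + v\<^sup>2 / \<epsilon>)\<close> with \<open>v = \<tau> q\<close> and \<open>\<epsilon> = C \<tau> / lam\<close>. This form puts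
  the square of \<open>v\<close> inside the bracket, where \<open>v\<^sup>2 / \<epsilon> \<le> \<tau> lam r\<close> has the same scale as the dissipation, and
  it does so for every step size. Stating the bound on \<open>q\<close> as \<open>q\<^sup>2 \<le> C * r\<close> includes \<open>C = 0\<close>, that is,
  the case without first-order term.
\<close>

lemma energy_step:
  fixes \<phi> :: "real \<Rightarrow> real^'d \<Rightarrow> real"
  assumes "0 < \<tau>" "0 < h" "0 < lam" "0 \<le> C"
    and a: "\<And>i. lam \<le> a i" "(\<Sum>i\<in>UNIV. a i) \<le> h\<^sup>2 / \<tau>"
    and u: "u = diff_avg \<tau> h a \<phi> t x + \<tau> * q"
    and q: "q\<^sup>2 \<le> C * r" and r: "0 \<le> r"
  shows "u\<^sup>2 \<le> (1 + C / lam * \<tau>) *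
    (diff_avg \<tau> h a (\<lambda>t x. (\<phi> t x)\<^sup>2) t x - \<tau> * lam * (norm (dgrad h \<phi> t x))\<^sup>2 + \<tau> * lam * r)"
proof -
  define m where "m = diff_avg \<tau> h a \<phi> t x"
  define \<epsilon> where "\<epsilon> = C / lam * \<tau>"
  have a0: "0 \<le> a i" for i using a(1)[of i] \<open>0 < lam\<close> by simp
  have "lam * (norm (dgrad h \<phi> t x))\<^sup>2 = (\<Sum>i\<in>UNIV. lam * (dgrad h \<phi> t x $ i)\<^sup>2)"
    by (simp add: norm_vec_def L2_set_def sum_nonneg sum_distrib_left)
  also have "\<dots> \<le> (\<Sum>i\<in>UNIV. a i * (dgrad h \<phi> t x $ i)\<^sup>2)"
    by (intro sum_mono mult_right_mono a) auto
  finally have "\<tau> * (lam * (norm (dgrad h \<phi> t x))\<^sup>2) \<le> \<tau> * (\<Sum>i\<in>UNIV. a i * (dgrad h \<phi> t x $ i)\<^sup>2)"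
    using \<open>0 < \<tau>\<close> by (intro mult_left_mono) auto
  then have m: "m\<^sup>2 \<le> diff_avg \<tau> h a (\<lambda>t x. (\<phi> t x)\<^sup>2) t x - \<tau> * lam * (norm (dgrad h \<phi> t x))\<^sup>2"
    using jensen_gap[OF assms(1,2) a0 a(2), of \<phi> t x] by (simp add: m_def algebra_simps)
  have \<epsilon>0: "0 \<le> \<epsilon>" using assms by (simp add: \<epsilon>_def)
  have "u\<^sup>2 \<le> (1 + \<epsilon>) * (m\<^sup>2 + \<tau> * lam * r)"
  proof (cases "C = 0")
    case True
    then have "q = 0" using q by simp
    then show ?thesis using True assms(1,3) r u by (simp add: \<epsilon>_def m_def)
  next
    case False
    then have C: "0 < C" and \<epsilon>: "0 < \<epsilon>" using assms by (auto simp: \<epsilon>_def)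
    have "\<tau>\<^sup>2 * q\<^sup>2 \<le> \<tau>\<^sup>2 * (C * r)" by (intro mult_left_mono q) auto
    also have "\<tau>\<^sup>2 * (C * r) = \<epsilon> * (\<tau> * lam * r)"
      using assms(3) by (simp add: \<epsilon>_def power2_eq_square)
    finally have v: "(\<tau> * q)\<^sup>2 \<le> \<epsilon> * (\<tau> * lam * r)" by (simp add: power_mult_distrib)
    define R where "R = \<tau> * lam * r"
    have "0 \<le> (\<epsilon> * m - \<tau> * q)\<^sup>2" by simp
    then have "2 * \<epsilon> * m * (\<tau> * q) \<le> \<epsilon>\<^sup>2 * m\<^sup>2 + (\<tau> * q)\<^sup>2"
      by (simp add: power2_eq_square algebra_simps)
    also have "\<dots> \<le> \<epsilon>\<^sup>2 * m\<^sup>2 + \<epsilon> * R" using v by (simp add: R_def)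
    finally have "\<epsilon> * (2 * m * (\<tau> * q)) \<le> \<epsilon> * (\<epsilon> * m\<^sup>2 + R)" 
      by (simp add: power2_eq_square algebra_simps)
    then have "2 * m * (\<tau> * q) \<le> \<epsilon> * m\<^sup>2 + R" using \<epsilon> by simp
    moreover have "u\<^sup>2 = m\<^sup>2 + 2 * m * (\<tau> * q) + (\<tau> * q)\<^sup>2"
      by (simp add: u m_def power2_eq_square algebra_simps)
    ultimately have "u\<^sup>2 \<le> m\<^sup>2 + \<epsilon> * m\<^sup>2 + R + \<epsilon> * R" using v by (simp add: R_def)
    then show ?thesis by (simp add: R_def algebra_simps)
  qed
  also have "\<dots> \<le> (1 + \<epsilon>) * (diff_avg \<tau> h a (\<lambda>t x. (\<phi> t x)\<^sup>2) t x
      - \<tau> * lam * (norm (dgrad h \<phi> t x))\<^sup>2 + \<tau> * lam * r)"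
    using m \<epsilon>0 by (intro mult_left_mono) auto
  finally show ?thesis by (simp add: \<epsilon>_def)
qed

text \<open>
  In the weighted sum \<open>G n\<close> appears twice: with coefficient \<open>- 2 ^ n * 47 / 48\<close> from its own index and with
  \<open>2 ^ (n + 1) / 12 = 2 ^ n / 6\<close> from the next one. The term \<open>2 ^ N * G N / 6\<close> on the right is the amount
  that the next index will use; it is there to make the induction close.
\<close>

lemma weighted_gradients_absorbed:
  fixes G :: "nat \<Rightarrow> real"
  assumes "\<And>n. 0 \<le> G n"
  shows "(\<Sum>n=1..N. 2 ^ n * (G n / 48 + G (n - 1) / 12 - G n)) \<le> G 0 / 6 - 2 ^ N * G N / 6"
proof (induction N)
  case 0
  then show ?case by simp
next
  case (Suc N)
  have "0 \<le> 2 ^ N * G (Suc N)" using assms by simp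
  with Suc show ?case by (simp add: algebra_simps)
qed

text \<open>
  The energy collects everything that can feed the error of the iteration. The gradient of \<open>W 0\<close>, which
  drives \<open>W 1\<close>, is at most the sum of those of \<open>U\<close> and \<open>U'\<close>, and the squares of these two functions
  bring the dissipation that pays for it. Once all gradients are absorbed, only the two constants
  \<open>1 / 24\<close> are left; they make up the forcing \<open>lam / 12 * \<tau>\<close>.
\<close>

lemma total_energy_step:
  fixes U U' :: "real \<Rightarrow> real^'d \<Rightarrow> real" and W :: "nat \<Rightarrow> real \<Rightarrow> real^'d \<Rightarrow> real" and N :: nat
  assumes "0 < \<tau>" "0 < h" "0 < lam" "0 \<le> C"
    and a: "\<And>i. lam \<le> a i" "(\<Sum>i\<in>UNIV. a i) \<le> h\<^sup>2 / \<tau>"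
    and U: "U (t - \<tau>) x = diff_avg \<tau> h a U t x + \<tau> * q"
      "q\<^sup>2 \<le> C * (1 / 24 + (norm (dgrad h U t x))\<^sup>2 / 48)"
    and U': "U' (t - \<tau>) x = diff_avg \<tau> h a U' t x + \<tau> * q'"
      "q'\<^sup>2 \<le> C * (1 / 24 + (norm (dgrad h U' t x))\<^sup>2 / 48)"
    and W: "\<And>n. 1 \<le> n \<Longrightarrow> W n (t - \<tau>) x = diff_avg \<tau> h a (W n) t x + \<tau> * p n"
      "\<And>n. 1 \<le> n \<Longrightarrow> (p n)\<^sup>2 \<le> C * ((norm (dgrad h (W n) t x))\<^sup>2 / 48
         + (norm (dgrad h (W (n - 1)) t x))\<^sup>2 / 12)"
    and W0: "W 0 = (\<lambda>s y. U' s y - U s y)"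
  defines "E \<equiv> \<lambda>s y. (U s y)\<^sup>2 + (U' s y)\<^sup>2 + (\<Sum>n=1..N. 2 ^ n * (W n s y)\<^sup>2)"
  shows "E (t - \<tau>) x \<le> (1 + C / lam * \<tau>) * (diff_avg \<tau> h a E t x + lam / 12 * \<tau>)"
proof -
  define G where "G \<phi> = (norm (dgrad h \<phi> t x))\<^sup>2" for \<phi> :: "real \<Rightarrow> real^'d \<Rightarrow> real"
  define Q where "Q \<phi> = diff_avg \<tau> h a (\<lambda>t x. (\<phi> t x)\<^sup>2) t x" for \<phi> :: "real \<Rightarrow> real^'d \<Rightarrow> real"
  define \<gamma> where "\<gamma> = 1 + C / lam * \<tau>"
  have G0: "0 \<le> G \<phi>" for \<phi> by (simp add: G_def)
  have \<gamma>: "0 \<le> \<gamma>" using assms by (simp add: \<gamma>_def)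
  have step: "u\<^sup>2 \<le> \<gamma> * (Q \<phi> - \<tau> * lam * G \<phi> + \<tau> * lam * r)"
    if "u = diff_avg \<tau> h a \<phi> t x + \<tau> * q" "q\<^sup>2 \<le> C * r" "0 \<le> r" for u q r and \<phi> :: "real \<Rightarrow> real^'d \<Rightarrow> real"
    using energy_step[OF assms(1-4) a that] by (simp add: G_def Q_def \<gamma>_def)
  have 1: "(U (t - \<tau>) x)\<^sup>2 \<le> \<gamma> * (Q U + \<tau> * lam * (1 / 24 - 47 / 48 * G U))"
    using step[OF U[folded G_def]] G0[of U] by (simp add: algebra_simps)
  have 2: "(U' (t - \<tau>) x)\<^sup>2 \<le> \<gamma> * (Q U' + \<tau> * lam * (1 / 24 - 47 / 48 * G U'))"
    using step[OF U'[folded G_def]] G0[of U'] by (simp add: algebra_simps)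
  have W_step: "2 ^ n * (W n (t - \<tau>) x)\<^sup>2 \<le> \<gamma> * (2 ^ n * Q (W n)
      + \<tau> * lam * (2 ^ n * (G (W n) / 48 + G (W (n - 1)) / 12 - G (W n))))" if "1 \<le> n" for n
  proof -
    have "(W n (t - \<tau>) x)\<^sup>2 \<le> \<gamma> * (Q (W n) - \<tau> * lam * G (W n)
        + \<tau> * lam * (G (W n) / 48 + G (W (n - 1)) / 12))"
      using step[OF W(1)[OF that] W(2)[OF that, folded G_def]] G0 by simp
    then have "2 ^ n * (W n (t - \<tau>) x)\<^sup>2 \<le> 2 ^ n * (\<gamma> * (Q (W n) - \<tau> * lam * G (W n)
        + \<tau> * lam * (G (W n) / 48 + G (W (n - 1)) / 12)))"
      by (intro mult_left_mono) auto
    then show ?thesis by (simp add: algebra_simps)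
  qed
  let ?S = "\<Sum>n=1..N. 2 ^ n * (G (W n) / 48 + G (W (n - 1)) / 12 - G (W n))"
  have "(\<Sum>n=1..N. 2 ^ n * (W n (t - \<tau>) x)\<^sup>2) \<le> (\<Sum>n=1..N. \<gamma> * (2 ^ n * Q (W n)
      + \<tau> * lam * (2 ^ n * (G (W n) / 48 + G (W (n - 1)) / 12 - G (W n)))))"
    by (intro sum_mono W_step) auto
  also have "\<dots> = \<gamma> * ((\<Sum>n=1..N. 2 ^ n * Q (W n)) + \<tau> * lam * ?S)"
    by (simp add: sum_distrib_left[symmetric] sum.distrib)
  finally have 3: "(\<Sum>n=1..N. 2 ^ n * (W n (t - \<tau>) x)\<^sup>2) \<le>
      \<gamma> * ((\<Sum>n=1..N. 2 ^ n * Q (W n)) + \<tau> * lam * ?S)" .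
  have avg: "diff_avg \<tau> h a E t x = Q U + Q U' + (\<Sum>n=1..N. 2 ^ n * Q (W n))"
    unfolding E_def Q_def by (simp add: diff_avg_add diff_avg_sum diff_avg_scale)
  have "?S \<le> G (W 0) / 6"
  proof -
    have "?S \<le> G (W 0) / 6 - 2 ^ N * G (W N) / 6"
      by (rule weighted_gradients_absorbed) (rule G0)
    moreover have "0 \<le> 2 ^ N * G (W N)" by (intro mult_nonneg_nonneg G0) simp
    ultimately show ?thesis by linarith
  qed
  moreover have "G (W 0) \<le> 2 * G U + 2 * G U'"
  proof -
    have "(norm (u - v))\<^sup>2 + (norm (u + v))\<^sup>2 = 2 * (norm u)\<^sup>2 + 2 * (norm v)\<^sup>2" for u v :: "real^'d"
      by (simp add: power2_norm_eq_inner inner_diff inner_add algebra_simps)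
    from this[of "dgrad h U' t x" "dgrad h U t x"]
      zero_le_power2[of "norm (dgrad h U' t x + dgrad h U t x)"]
    show ?thesis unfolding G_def W0 dgrad_minus by linarith
  qed
  ultimately have "(1 / 24 - 47 / 48 * G U) + (1 / 24 - 47 / 48 * G U') + ?S \<le> 1 / 12"
    using G0[of U] G0[of U'] by linarith
  then have "\<tau> * lam * ((1 / 24 - 47 / 48 * G U) + (1 / 24 - 47 / 48 * G U') + ?S) \<le> \<tau> * lam * (1 / 12)"
    using assms(1,3) by (intro mult_left_mono) auto
  then have "\<gamma> * (Q U + \<tau> * lam * (1 / 24 - 47 / 48 * G U)
       + (Q U' + \<tau> * lam * (1 / 24 - 47 / 48 * G U'))
       + ((\<Sum>n=1..N. 2 ^ n * Q (W n)) + \<tau> * lam * ?S))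
     \<le> \<gamma> * (diff_avg \<tau> h a E t x + lam / 12 * \<tau>)"
    using \<gamma> by (intro mult_left_mono) (auto simp: avg algebra_simps)
  then show ?thesis
    using 1 2 3 unfolding E_def[of] \<gamma>_def[symmetric] by (simp add: distrib_left)
qed

text \<open>
  A discrete Gronwall estimate: by the maximum principle one step multiplies a bound by \<open>1 + \<rho> * \<tau>\<close> after
  adding \<open>\<kappa> * \<tau>\<close>, and there are \<open>T / \<tau>\<close> steps.
\<close>

lemma backward_growth_bound:
  fixes E :: "real \<Rightarrow> real^'d \<Rightarrow> real" and a :: "real \<Rightarrow> real^'d \<Rightarrow> 'd \<Rightarrow> real"
  assumes "0 < \<tau>" "0 < h" "0 \<le> \<rho>" "0 \<le> \<kappa>" "0 \<le> M" and N: "T / \<tau> \<in> \<nat>"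
    and a: "\<And>t x i. (t, x) \<in> grid T \<tau> h \<Longrightarrow> 0 \<le> a t x i"
      "\<And>t x. (t, x) \<in> grid T \<tau> h \<Longrightarrow> (\<Sum>i\<in>UNIV. a t x i) \<le> h\<^sup>2 / \<tau>"
    and step: "\<And>t x. t \<in> time_grid T \<tau> - {0} \<Longrightarrow> x \<in> space_grid h \<Longrightarrow>
      E (t - \<tau>) x \<le> (1 + \<rho> * \<tau>) * (diff_avg \<tau> h (a t x) E t x + \<kappa> * \<tau>)"
    and terminal: "\<And>x. x \<in> space_grid h \<Longrightarrow> E T x \<le> M"
    and tx: "(t, x) \<in> grid T \<tau> h"
  shows "E t x \<le> exp (\<rho> * T) * (M + \<kappa> * T)"
proof -
  obtain N :: nat where "T / \<tau> = real N" using N by (auto elim: Nats_cases)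
  then have TN: "T = real N * \<tau>" using assms(1) by (simp add: field_simps)
  have bound: "\<forall>x\<in>space_grid h. E (real (N - k) * \<tau>) x \<le> (1 + \<rho> * \<tau>) ^ k * (M + \<kappa> * (real k * \<tau>))"
    if "k \<le> N" for k
    using that
  proof (induction k)
    case 0
    then show ?case using terminal TN by simp
  next
    case (Suc k)
    let ?t = "real (N - k) * \<tau>"
    let ?R = "(1 + \<rho> * \<tau>) ^ k * (M + \<kappa> * (real k * \<tau>))"
    have t: "?t \<in> time_grid T \<tau> - {0}"
      using Suc.prems assms(1) by (auto simp: time_grid_def TN intro!: exI[of _ "N - k"])
    have prev: "real (N - Suc k) * \<tau> = ?t - \<tau>"
    proof -
      have "N - k = Suc (N - Suc k)" using Suc.prems by simp
      then show ?thesis by (simp add: algebra_simps)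
    qed
    show ?case
    proof
      fix x :: "real^'d" assume x: "x \<in> space_grid h"
      have g: "(?t, x) \<in> grid T \<tau> h" using t x by (auto simp: grid_def)
      have "diff_avg \<tau> h (a ?t x) E ?t x \<le> ?R"
        using diff_avg_le[OF assms(1,2) a(1)[OF g] a(2)[OF g] x, of E ?t ?R] Suc by auto
      moreover have "\<kappa> * \<tau> \<le> (1 + \<rho> * \<tau>) ^ k * (\<kappa> * \<tau>)"
        using mult_right_mono[OF one_le_power[of "1 + \<rho> * \<tau>" k], of "\<kappa> * \<tau>"] assms by simp
      ultimately have "(1 + \<rho> * \<tau>) * (diff_avg \<tau> h (a ?t x) E ?t x + \<kappa> * \<tau>)
          \<le> (1 + \<rho> * \<tau>) * (?R + (1 + \<rho> * \<tau>) ^ k * (\<kappa> * \<tau>))"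
        using assms by (intro mult_left_mono) auto
      also have "\<dots> = (1 + \<rho> * \<tau>) ^ Suc k * (M + \<kappa> * (real (Suc k) * \<tau>))"
        by (simp add: algebra_simps)
      finally show "E (real (N - Suc k) * \<tau>) x \<le> (1 + \<rho> * \<tau>) ^ Suc k * (M + \<kappa> * (real (Suc k) * \<tau>))"
        using step[OF t x] prev by simp
    qed
  qed
  obtain j :: nat where j: "t = real j * \<tau>" "real j * \<tau> \<le> T" and x: "x \<in> space_grid h"
    using tx by (auto simp: grid_def time_grid_def)
  have jN: "j \<le> N" using j(2) assms(1) by (simp add: TN)
  define k where "k = N - j"
  have k: "k \<le> N" "t = real (N - k) * \<tau>" using jN j by (auto simp: k_def)
  have kT: "real k * \<tau> \<le> T" using k(1) assms(1) by (simp add: TN)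
  have "(1 + \<rho> * \<tau>) ^ k \<le> exp (\<rho> * \<tau>) ^ k"
    using assms by (intro power_mono) auto
  also have "\<dots> = exp (\<rho> * (real k * \<tau>))" by (simp add: exp_of_nat_mult[symmetric] algebra_simps)
  also have "\<dots> \<le> exp (\<rho> * T)" using kT assms(3) by (simp add: mult_left_mono)
  finally have "(1 + \<rho> * \<tau>) ^ k * (M + \<kappa> * (real k * \<tau>)) \<le> exp (\<rho> * T) * (M + \<kappa> * T)"
    using kT assms by (intro mult_mono add_mono mult_left_mono) auto
  then show ?thesis using bound[OF k(1)] x k(2) by fastforce
qed

section \<open>The Hamiltonian and its policies\<close>

text \<open>
  Optimal responses turn the supremum and infimum in \<open>Ham\<close> into a maximum and a minimum. This identifies \<open>Ham\<close>
  for any selection of optimisers, so the same lemma serves the selection inside the iteration and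
  the given one, and no two selections have to be compared.
\<close>

lemma Ham_eq_policy_value:
  assumes min: "\<And>b. b \<in> B \<Longrightarrow> is_arg_min (\<lambda>a. Lag c f t x p a b) (\<lambda>a. a \<in> A) (r b)"
    and max: "is_arg_max (\<lambda>b. Lag c f t x p (r b) b) (\<lambda>b. b \<in> B) b'"
  shows "Ham A B c f t x p = Lag c f t x p (r b') b'"
proof -
  have inf: "(INF a\<in>A. Lag c f t x p a b) = Lag c f t x p (r b) b" if "b \<in> B" for b
    using min[OF that] by (intro cInf_eq_minimum) (auto simp: is_arg_min_def not_less)
  have "(SUP b\<in>B. INF a\<in>A. Lag c f t x p a b) = (SUP b\<in>B. Lag c f t x p (r b) b)"
    using inf by simp
  also have "\<dots> = Lag c f t x p (r b') b'"
    using max by (intro cSup_eq_maximum) (auto simp: is_arg_max_def not_less)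
  finally show ?thesis by (simp add: Ham_def)
qed

lemma Ham_attained:
  assumes min: "\<And>b. b \<in> B \<Longrightarrow> is_arg_min (\<lambda>a. Lag c f t x p a b) (\<lambda>a. a \<in> A) (r b)"
    and max: "\<exists>b'. is_arg_max (\<lambda>b. Lag c f t x p (r b) b) (\<lambda>b. b \<in> B) b'"
  shows "\<exists>a\<in>A. \<exists>b\<in>B. Ham A B c f t x p = Lag c f t x p a b"
proof -
  obtain b where b: "is_arg_max (\<lambda>b. Lag c f t x p (r b) b) (\<lambda>b. b \<in> B) b" using max by blast
  then have "b \<in> B" by (simp add: is_arg_max_def)
  moreover have "r b \<in> A" using min[OF \<open>b \<in> B\<close>] by (simp add: is_arg_min_def)
  moreover have "Ham A B c f t x p = Lag c f t x p (r b) b" by (rule Ham_eq_policy_value[OF min b])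
  ultimately show ?thesis by blast
qed

lemma Lag_lipschitz:
  fixes f :: "real \<Rightarrow> real^'d \<Rightarrow> 'a \<Rightarrow> 'b \<Rightarrow> real^'d"
  assumes "norm (f t x a b) \<le> F"
  shows "\<bar>Lag c f t x p a b - Lag c f t x p' a b\<bar> \<le> F * norm (p - p')"
proof -
  have "\<bar>(p - p') \<bullet> f t x a b\<bar> \<le> norm (p - p') * norm (f t x a b)" by (rule Cauchy_Schwarz_ineq2)
  also have "\<dots> \<le> norm (p - p') * F" using assms by (intro mult_left_mono) auto
  finally show ?thesis by (simp add: Lag_def inner_diff_left mult.commute)
qed

lemma Lag_growth:
  fixes f :: "real \<Rightarrow> real^'d \<Rightarrow> 'a \<Rightarrow> 'b \<Rightarrow> real^'d"
  assumes "norm (f t x a b) \<le> F" "\<bar>c t x a b\<bar> \<le> K"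
  shows "\<bar>Lag c f t x p a b\<bar> \<le> K + F * norm p"
  using Lag_lipschitz[of f t x a b F c p 0, OF assms(1)] assms(2) by (simp add: Lag_def)

text \<open>
  Let the maximiser at \<open>p\<close> meet the minimising response for \<open>p'\<close>. At \<open>p\<close> this response is only worse for the
  minimiser, at \<open>p'\<close> this choice of \<open>b\<close> is only worse for the maximiser, and between the two stands the
  Lipschitz bound of \<open>Lag\<close> for one fixed pair of controls.
\<close>

lemma Ham_le_lipschitz:
  fixes f :: "real \<Rightarrow> real^'d \<Rightarrow> 'a \<Rightarrow> 'b \<Rightarrow> real^'d" and s :: "'b \<Rightarrow> real^'d \<Rightarrow> 'a"
  assumes F: "\<And>a b. a \<in> A \<Longrightarrow> b \<in> B \<Longrightarrow> norm (f t x a b) \<le> F"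
    and min: "\<And>p b. b \<in> B \<Longrightarrow> is_arg_min (\<lambda>a. Lag c f t x p a b) (\<lambda>a. a \<in> A) (s b p)"
    and max: "\<And>p. \<exists>b'. is_arg_max (\<lambda>b. Lag c f t x p (s b p) b) (\<lambda>b. b \<in> B) b'"
  shows "Ham A B c f t x p \<le> Ham A B c f t x p' + F * norm (p - p')"
proof -
  obtain b where b: "is_arg_max (\<lambda>b. Lag c f t x p (s b p) b) (\<lambda>b. b \<in> B) b" using max by blast
  obtain b' where b': "is_arg_max (\<lambda>b. Lag c f t x p' (s b p') b) (\<lambda>b. b \<in> B) b'" using max by blast
  have bB: "b \<in> B" using b by (simp add: is_arg_max_def)
  have sA: "s b p' \<in> A" using min[OF bB] by (simp add: is_arg_min_def)
  have "Ham A B c f t x p = Lag c f t x p (s b p) b"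
    by (rule Ham_eq_policy_value[of B c f t x p A "\<lambda>b. s b p"]) (use min b in auto)
  also have "\<dots> \<le> Lag c f t x p (s b p') b"
    using min[OF bB, of p] sA by (auto simp: is_arg_min_def not_less)
  also have "\<dots> \<le> Lag c f t x p' (s b p') b + F * norm (p - p')"
    using Lag_lipschitz[of f t x "s b p'" b F c p p'] F[OF sA bB] by (simp add: abs_le_iff)
  also have "Lag c f t x p' (s b p') b \<le> Lag c f t x p' (s b' p') b'"
    using b' bB by (auto simp: is_arg_max_def not_less)
  also have "\<dots> = Ham A B c f t x p'"
    by (rule Ham_eq_policy_value[of B c f t x p' A "\<lambda>b. s b p'", symmetric]) (use min b' in auto)
  finally show ?thesis by simp
qed

lemma Ham_lipschitz:
  fixes f :: "real \<Rightarrow> real^'d \<Rightarrow> 'a \<Rightarrow> 'b \<Rightarrow> real^'d" and s :: "'b \<Rightarrow> real^'d \<Rightarrow> 'a"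
  assumes F: "\<And>a b. a \<in> A \<Longrightarrow> b \<in> B \<Longrightarrow> norm (f t x a b) \<le> F"
    and min: "\<And>p b. b \<in> B \<Longrightarrow> is_arg_min (\<lambda>a. Lag c f t x p a b) (\<lambda>a. a \<in> A) (s b p)"
    and max: "\<And>p. \<exists>b'. is_arg_max (\<lambda>b. Lag c f t x p (s b p) b) (\<lambda>b. b \<in> B) b'"
  shows "\<bar>Ham A B c f t x p - Ham A B c f t x p'\<bar> \<le> F * norm (p - p')"
  using Ham_le_lipschitz[OF assms, of p p'] Ham_le_lipschitz[OF assms, of p' p]
  by (simp add: norm_minus_commute)

section \<open>Convergence of policy iteration\<close>

lemma norm_le_sup_norm:
  assumes "bounded (u ` D)" "z \<in> D"
  shows "norm (u z) \<le> sup_norm D u"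
proof -
  have "bdd_above ((\<lambda>z. norm (u z)) ` D)"
    using assms(1) by (auto simp: bounded_iff bdd_above_def)
  then show ?thesis unfolding sup_norm_def using assms(2) by (intro cSUP_upper)
qed

lemma bdd_above_and_SUP_le:
  fixes \<phi> :: "'a \<Rightarrow> 'b \<Rightarrow> real"
  assumes "D \<noteq> {}" "\<And>t x. (t, x) \<in> D \<Longrightarrow> \<phi> t x \<le> M"
  shows "bdd_above ((\<lambda>(t, x). \<phi> t x) ` D) \<and> (SUP (t, x) \<in> D. \<phi> t x) \<le> M"
  using assms by (auto intro!: bdd_aboveI2 cSUP_least)

lemma scheme_step:
  assumes "solves_scheme T \<tau> h \<nu> \<sigma> g F V" "0 < \<tau>" "t \<in> time_grid T \<tau> - {0}" "x \<in> space_grid h"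
  shows "V (t - \<tau>) x = diff_avg \<tau> h (\<lambda>i. Sig \<sigma> i t x + \<nu>) V t x + \<tau> * F t x (dgrad h V t x)"
proof -
  have "dt \<tau> V t x + F t x (dgrad h V t x)
          = - (1/2) * (\<Sum>i\<in>UNIV. (Sig \<sigma> i t x + \<nu>) * dlap h i V t x)"
    using assms by (auto simp: solves_scheme_def)
  then have "\<tau> * (dt \<tau> V t x + F t x (dgrad h V t x))
     = \<tau> * (- (1/2) * (\<Sum>i\<in>UNIV. (Sig \<sigma> i t x + \<nu>) * dlap h i V t x))" by simp
  then show ?thesis using assms(2) by (simp add: dt_def diff_avg_def distrib_left)
qed

theorem corollary1p2:
  fixes T \<tau> h \<nu> lam Lam C1 Ch :: real
    and A :: "(real^'ma) set" and B :: "(real^'mb) set"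
    and c :: "real \<Rightarrow> real^'d \<Rightarrow> real^'ma \<Rightarrow> real^'mb \<Rightarrow> real"
    and f :: "real \<Rightarrow> real^'d \<Rightarrow> real^'ma \<Rightarrow> real^'mb \<Rightarrow> real^'d"
    and g :: "real^'d \<Rightarrow> real"
    and \<sigma> :: "real \<Rightarrow> real^'d \<Rightarrow> real^'d^'d"
    and sel :: "real^'mb \<Rightarrow> real \<Rightarrow> real^'d \<Rightarrow> real^'d \<Rightarrow> real^'ma"
    and V :: "real \<Rightarrow> real^'d \<Rightarrow> real"
    and Vn :: "nat \<Rightarrow> real \<Rightarrow> real^'d \<Rightarrow> real"
    and resp :: "nat \<Rightarrow> real^'mb \<Rightarrow> real \<Rightarrow> real^'d \<Rightarrow> real^'ma"
    and \<alpha> :: "nat \<Rightarrow> real \<Rightarrow> real^'d \<Rightarrow> real^'ma"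
    and \<beta> :: "nat \<Rightarrow> real \<Rightarrow> real^'d \<Rightarrow> real^'mb"
  assumes T: "T > 0"
    and compact_A: "compact A" and compact_B: "compact B"
    and c_bounded: "bounded ((\<lambda>(t, x, a, b). c t x a b) ` ({0..T} \<times> UNIV \<times> A \<times> B))"
    and f_bounded: "bounded ((\<lambda>(t, x, a, b). f t x a b) ` ({0..T} \<times> UNIV \<times> A \<times> B))"
    and g_bounded: "bounded (range g)"
    and \<sigma>_bounded: "bounded ((\<lambda>(t, x). \<sigma> t x) ` ({0..T} \<times> UNIV))"
    and \<sigma>_diag: "\<And>t x i j. t \<in> {0..T} \<Longrightarrow> i \<noteq> j \<Longrightarrow> \<sigma> t x $ i $ j = 0"
    and sel_min: "\<And>t x p b. (t, x) \<in> grid T \<tau> h \<Longrightarrow> b \<in> B \<Longrightarrow>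
          is_arg_min (\<lambda>a. Lag c f t x p a b) (\<lambda>a. a \<in> A) (sel b t x p)"
    and sel_max: "\<And>t x p. (t, x) \<in> grid T \<tau> h \<Longrightarrow>
          \<exists>b\<^sub>0. is_arg_max (\<lambda>b. Lag c f t x p (sel b t x p) b) (\<lambda>b. b \<in> B) b\<^sub>0"
    and h: "0 < h" "h < 1" and \<tau>: "0 < \<tau>" "\<tau> < 1" "T / \<tau> \<in> \<nat>"
    and \<nu>: "\<nu> \<ge> 0"
    and monotone_f: "\<And>i t x a b. t \<in> {0..T} \<Longrightarrow> a \<in> A \<Longrightarrow> b \<in> B \<Longrightarrow>
          \<nu> + Sig \<sigma> i t x \<ge> h * \<bar>f t x a b $ i\<bar>"
    and monotone_\<tau>: "real CARD('d) * \<nu>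
          + (SUP (t, x) \<in> grid T \<tau> h. \<Sum>i\<in>UNIV. Sig \<sigma> i t x) \<le> h\<^sup>2 / \<tau>"
    and step1: "real CARD('d) * \<tau> *
          (MAX i. sup_norm ({0..T} \<times> UNIV) (\<lambda>(t, x). Sig \<sigma> i t x)) \<le> 4 * h\<^sup>2"
    and step2: "96 * \<tau> * max ((sup_norm ({0..T} \<times> UNIV \<times> A \<times> B) (\<lambda>(t, x, a, b). c t x a b))\<^sup>2)
            (2 * real CARD('d) * (sup_norm ({0..T} \<times> UNIV \<times> A \<times> B) (\<lambda>(t, x, a, b). f t x a b))\<^sup>2)
          \<le> (MIN i. INF (t, x) \<in> {0..T} \<times> UNIV. Sig \<sigma> i t x) + \<nu>"
    and Lam_lam: "Lam > lam" "lam \<ge> \<nu>" "0 < lam"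
    and ellipticity: "\<And>i t x. t \<in> {0..T} \<Longrightarrow> lam \<le> Sig \<sigma> i t x + \<nu> \<and> Sig \<sigma> i t x + \<nu> \<le> Lam"
    and V: "solves_scheme T \<tau> h \<nu> \<sigma> g (Ham A B c f) V"
    and \<alpha>0: "\<And>t x. t \<in> {0..T} \<Longrightarrow> \<alpha> 0 t x \<in> A"
            "\<exists>K. K-lipschitz_on ({0..T} \<times> UNIV) (\<lambda>(t, x). \<alpha> 0 t x)"
    and \<beta>0: "\<And>t x. t \<in> {0..T} \<Longrightarrow> \<beta> 0 t x \<in> B"
            "\<exists>K. K-lipschitz_on ({0..T} \<times> UNIV) (\<lambda>(t, x). \<beta> 0 t x)"
    and Vn: "\<And>n. solves_scheme T \<tau> h \<nu> \<sigma> g (\<lambda>t x p. Lag c f t x p (\<alpha> n t x) (\<beta> n t x)) (Vn n)"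
    and improve: "\<And>n. improved_policy T \<tau> h A B c f (Vn n)
            (resp (Suc n)) (\<alpha> (Suc n)) (\<beta> (Suc n))"
    and C1: "C1 = 48 * max ((sup_norm ({0..T} \<times> UNIV \<times> A \<times> B) (\<lambda>(t, x, a, b). c t x a b))\<^sup>2)
            (2 * real CARD('d) * (sup_norm ({0..T} \<times> UNIV \<times> A \<times> B) (\<lambda>(t, x, a, b). f t x a b))\<^sup>2)"
    and Ch: "Ch = exp (C1 * T / lam) * (12 * (sup_norm UNIV g)\<^sup>2 + T * lam)"
  shows "\<forall>n\<ge>1. \<forall>i.
     bdd_above ((\<lambda>(t, x). \<bar>fdiff h i (\<lambda>s y. Vn n s y - V s y) t x\<bar>\<^sup>2) ` grid T \<tau> h) \<and>
     (SUP (t, x) \<in> grid T \<tau> h. \<bar>fdiff h i (\<lambda>s y. Vn n s y - V s y) t x\<bar>\<^sup>2)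
       \<le> Ch * h powi (-2) * 2 powi (1 - int n) \<and>
     bdd_above ((\<lambda>(t, x). \<bar>Lag c f t x (dgrad h V t x) (\<alpha> n t x) (\<beta> n t x)
                  - Ham A B c f t x (dgrad h V t x)\<bar>\<^sup>2) ` grid T \<tau> h) \<and>
     (SUP (t, x) \<in> grid T \<tau> h. \<bar>Lag c f t x (dgrad h V t x) (\<alpha> n t x) (\<beta> n t x)
                  - Ham A B c f t x (dgrad h V t x)\<bar>\<^sup>2)
       \<le> 16 * real CARD('d) * Ch * (sup_norm ({0..T} \<times> UNIV \<times> A \<times> B) (\<lambda>(t, x, a, b). f t x a b))\<^sup>2
           * h powi (-2) * 2 powi (1 - int n)"
proof -
  define D where "D = {0..T} \<times> (UNIV :: (real^'d) set) \<times> A \<times> B"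
  define F where "F = sup_norm D (\<lambda>(t, x, a, b). f t x a b)"
  define K where "K = sup_norm D (\<lambda>(t, x, a, b). c t x a b)"
  define S where "S = sup_norm UNIV g"
  define d where "d = real CARD('d)"
  define w where "w t x = (\<lambda>i. Sig \<sigma> i t x + \<nu>)" for t x
  define W where "W n = (\<lambda>s y. Vn n s y - V s y)" for n
  have d1: "1 \<le> d" by (simp add: d_def Suc_leI)
  have grid_time: "t \<in> {0..T}" if "(t, x) \<in> grid T \<tau> h" for t and x :: "real^'d"
    using that \<tau> by (auto simp: grid_def time_grid_def)
  have F_bd: "norm (f t x a b) \<le> F" and K_bd: "\<bar>c t x a b\<bar> \<le> K"
    if "t \<in> {0..T}" "a \<in> A" "b \<in> B" for t x a b
    using norm_le_sup_norm[OF f_bounded, of "(t, x, a, b)"]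
      norm_le_sup_norm[OF c_bounded, of "(t, x, a, b)"] that
    by (auto simp: F_def K_def D_def)
  have S_bd: "\<bar>g x\<bar> \<le> S" for x
    using norm_le_sup_norm[OF g_bounded, of x] by (simp add: S_def)
  have F0: "0 \<le> F"
    using F_bd[of 0 "\<alpha> 0 0 0" "\<beta> 0 0 0" 0] \<alpha>0(1)[of 0 0] \<beta>0(1)[of 0 0] T norm_ge_zero
    by (meson atLeastAtMost_iff less_imp_le order_refl order_trans)
  have C1_eq: "C1 = 48 * max (K\<^sup>2) (2 * d * F\<^sup>2)"
    using C1 by (simp add: F_def K_def D_def d_def)
  have K2: "K\<^sup>2 \<le> C1 / 48" unfolding C1_eq by simp
  \<comment> \<open>The dimension is at least one, so the factor \<open>d\<close> inside \<open>C1\<close> can be dropped here.\<close>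
  have F2: "F\<^sup>2 \<le> C1 / 96"
  proof -
    have "1 * F\<^sup>2 \<le> d * F\<^sup>2" using d1 by (intro mult_right_mono) auto
    then show ?thesis unfolding C1_eq by simp
  qed
  have C1_0: "0 \<le> C1" using K2 zero_le_power2[of K] by linarith
  have w_lower: "lam \<le> w t x i" if "(t, x) \<in> grid T \<tau> h" for t x i
    using ellipticity[OF grid_time[OF that]] by (simp add: w_def)
  have w_sum: "(\<Sum>i\<in>UNIV. w t x i) \<le> h\<^sup>2 / \<tau>" if tx: "(t, x) \<in> grid T \<tau> h" for t x
  proof -
    have "bdd_above ((\<lambda>(t, x). \<Sum>i\<in>UNIV. Sig \<sigma> i t x) ` grid T \<tau> h)"
    proof (rule bdd_aboveI2)
      fix z :: "real \<times> (real^'d)" assume "z \<in> grid T \<tau> h"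
      then have "Sig \<sigma> i (fst z) (snd z) \<le> Lam - \<nu>" for i
        using ellipticity[of "fst z" i "snd z"] grid_time[of "fst z" "snd z"] by simp
      then show "(case z of (t, x) \<Rightarrow> \<Sum>i\<in>UNIV. Sig \<sigma> i t x) \<le> (\<Sum>i\<in>(UNIV::'d set). Lam - \<nu>)"
        by (auto simp: case_prod_beta intro!: sum_mono simp del: sum_constant)
    qed
    from cSUP_upper[OF tx this] monotone_\<tau> show ?thesis
      by (simp add: w_def sum.distrib)
  qed
  have policy: "\<alpha> n t x \<in> A" "\<beta> n t x \<in> B" if tx: "(t, x) \<in> grid T \<tau> h" for n t x
  proof -
    have "\<alpha> n t x \<in> A \<and> \<beta> n t x \<in> B"
    proof (cases n)
      case 0
      then show ?thesis using \<alpha>0(1) \<beta>0(1) grid_time[OF tx] by simp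
    next
      case (Suc m)
      then show ?thesis using improve[of m] tx
        by (fastforce simp: improved_policy_def is_arg_min_def is_arg_max_def)
    qed
    then show "\<alpha> n t x \<in> A" "\<beta> n t x \<in> B" by auto
  qed
  have improved: "Ham A B c f t x (dgrad h (Vn n) t x)
      = Lag c f t x (dgrad h (Vn n) t x) (\<alpha> (Suc n) t x) (\<beta> (Suc n) t x)"
    if tx: "(t, x) \<in> grid T \<tau> h" for n t x
  proof -
    have "\<forall>b\<in>B. is_arg_min (\<lambda>a. Lag c f t x (dgrad h (Vn n) t x) a b) (\<lambda>a. a \<in> A) (resp (Suc n) b t x)"
      "is_arg_max (\<lambda>b. Lag c f t x (dgrad h (Vn n) t x) (resp (Suc n) b t x) b) (\<lambda>b. b \<in> B) (\<beta> (Suc n) t x)"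
      "\<alpha> (Suc n) t x = resp (Suc n) (\<beta> (Suc n) t x) t x"
      using improve[of n] tx by (auto simp: improved_policy_def)
    then show ?thesis
      using Ham_eq_policy_value[of B c f t x "dgrad h (Vn n) t x" A "\<lambda>b. resp (Suc n) b t x"] by simp
  qed
  \<comment> \<open>The new policy is optimal for the gradient of \<open>Vn n\<close>, not for that of \<open>V\<close>. Moving from one gradient
    to the other costs one Lipschitz constant \<open>F\<close> for \<open>Lag\<close> and one for \<open>Ham\<close>.\<close>
  have gap: "\<bar>Lag c f t x (dgrad h V t x) (\<alpha> (Suc n) t x) (\<beta> (Suc n) t x)
      - Ham A B c f t x (dgrad h V t x)\<bar> \<le> 2 * F * norm (dgrad h (W n) t x)"
    if tx: "(t, x) \<in> grid T \<tau> h" for n t x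
  proof -
    let ?p = "dgrad h V t x" and ?q = "dgrad h (Vn n) t x"
    let ?L = "\<lambda>p. Lag c f t x p (\<alpha> (Suc n) t x) (\<beta> (Suc n) t x)"
    have "\<bar>?L ?q - ?L ?p\<bar> \<le> F * norm (?q - ?p)"
      by (intro Lag_lipschitz F_bd grid_time[OF tx] policy[OF tx])
    moreover have "\<bar>Ham A B c f t x ?q - Ham A B c f t x ?p\<bar> \<le> F * norm (?q - ?p)"
      by (rule Ham_lipschitz[where s = "\<lambda>b p. sel b t x p"])
        (use F_bd grid_time[OF tx] sel_min[OF tx] sel_max[OF tx] in auto)
    ultimately show ?thesis
      unfolding W_def dgrad_minus using improved[OF tx, of n] by linarith
  qed
  have sq_growth: "q\<^sup>2 \<le> C1 * (1 / 24 + y\<^sup>2 / 48)" if "\<bar>q\<bar> \<le> K + F * y" for q y :: real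
  proof -
    have "q\<^sup>2 \<le> (K + F * y)\<^sup>2" using power_mono[OF that, of 2] by simp
    also have "\<dots> \<le> 2 * K\<^sup>2 + 2 * (F\<^sup>2 * y\<^sup>2)"
      using zero_le_power2[of "K - F * y"] by (simp add: power2_eq_square algebra_simps)
    also have "\<dots> \<le> 2 * (C1 / 48) + 2 * (C1 / 96 * y\<^sup>2)"
      using K2 F2 by (intro add_mono mult_left_mono mult_right_mono) auto
    finally show ?thesis by (simp add: algebra_simps)
  qed
  have sq_gap: "p\<^sup>2 \<le> C1 * (y\<^sup>2 / 48 + z\<^sup>2 / 12)" if "\<bar>p\<bar> \<le> F * y + 2 * F * z" for p y z :: real
  proof -
    have "p\<^sup>2 \<le> (F * y + 2 * F * z)\<^sup>2" using power_mono[OF that, of 2] by simp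
    also have "\<dots> \<le> F\<^sup>2 * (2 * y\<^sup>2 + 8 * z\<^sup>2)"
      using zero_le_power2[of "F * y - 2 * F * z"] by (simp add: power2_eq_square algebra_simps)
    also have "\<dots> \<le> C1 / 96 * (2 * y\<^sup>2 + 8 * z\<^sup>2)"
      using F2 by (intro mult_right_mono) auto
    finally show ?thesis by (simp add: algebra_simps)
  qed
  define R where "R = exp (C1 * T / lam) * (2 * S\<^sup>2 + T * lam / 12)"
  \<comment> \<open>The total energy of the first \<open>N\<close> iterates. Since \<open>N\<close> is free while its bound \<open>R\<close> is not, each
    summand gives \<open>2 ^ n * (W n)\<^sup>2 \<le> R\<close>.\<close>
  define E where "E N = (\<lambda>s y. (V s y)\<^sup>2 + (Vn 0 s y)\<^sup>2 + (\<Sum>n=1..N. 2 ^ n * (W n s y)\<^sup>2))" for N :: nat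
  have E_step: "E N (t - \<tau>) x \<le> (1 + C1 / lam * \<tau>) * (diff_avg \<tau> h (w t x) (E N) t x + lam / 12 * \<tau>)"
    if t: "t \<in> time_grid T \<tau> - {0}" and x: "x \<in> space_grid h" for N t x
  proof -
    have tx: "(t, x) \<in> grid T \<tau> h" using t x by (auto simp: grid_def)
    have eq: "u (t - \<tau>) x = diff_avg \<tau> h (w t x) u t x + \<tau> * G t x (dgrad h u t x)"
      if "solves_scheme T \<tau> h \<nu> \<sigma> g G u" for G u
      using scheme_step[OF that \<tau>(1) t x] by (simp add: w_def)
    have eq_V: "(Ham A B c f t x (dgrad h V t x))\<^sup>2 \<le> C1 * (1 / 24 + (norm (dgrad h V t x))\<^sup>2 / 48)"
    proof (rule sq_growth)
      obtain a b where "a \<in> A" "b \<in> B" "Ham A B c f t x (dgrad h V t x) = Lag c f t x (dgrad h V t x) a b"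
        using Ham_attained[of B c f t x "dgrad h V t x" A "\<lambda>b. sel b t x (dgrad h V t x)"]
          sel_min[OF tx] sel_max[OF tx] by blast
      then show "\<bar>Ham A B c f t x (dgrad h V t x)\<bar> \<le> K + F * norm (dgrad h V t x)"
        using Lag_growth F_bd K_bd grid_time[OF tx] by metis
    qed
    have eq_V0: "(Lag c f t x (dgrad h (Vn 0) t x) (\<alpha> 0 t x) (\<beta> 0 t x))\<^sup>2
        \<le> C1 * (1 / 24 + (norm (dgrad h (Vn 0) t x))\<^sup>2 / 48)"
      by (rule sq_growth[OF Lag_growth])
        (use F_bd K_bd grid_time[OF tx] policy[OF tx] in blast)+
    define p where "p n = Lag c f t x (dgrad h (Vn n) t x) (\<alpha> n t x) (\<beta> n t x)
        - Ham A B c f t x (dgrad h V t x)" for n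
    have W_eq: "W n (t - \<tau>) x = diff_avg \<tau> h (w t x) (W n) t x + \<tau> * p n" for n
      using eq[OF V] eq[OF Vn[of n]] by (simp add: W_def p_def diff_avg_minus algebra_simps)
    have p_bd: "(p n)\<^sup>2 \<le> C1 * ((norm (dgrad h (W n) t x))\<^sup>2 / 48 + (norm (dgrad h (W (n - 1)) t x))\<^sup>2 / 12)"
      if "1 \<le> n" for n
    proof (rule sq_gap)
      have n: "n = Suc (n - 1)" using that by simp
      have "\<bar>Lag c f t x (dgrad h (Vn n) t x) (\<alpha> n t x) (\<beta> n t x)
          - Lag c f t x (dgrad h V t x) (\<alpha> n t x) (\<beta> n t x)\<bar> \<le> F * norm (dgrad h (W n) t x)"
        unfolding W_def dgrad_minus
        by (intro Lag_lipschitz F_bd grid_time[OF tx] policy[OF tx])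
      with gap[OF tx, of "n - 1", folded n]
      show "\<bar>p n\<bar> \<le> F * norm (dgrad h (W n) t x) + 2 * F * norm (dgrad h (W (n - 1)) t x)"
        unfolding p_def by linarith
    qed
    show ?thesis
      unfolding E_def
      by (rule total_energy_step[where U = V and U' = "Vn 0" and W = W and p = p, OF \<tau>(1) h(1) Lam_lam(3) C1_0 w_lower[OF tx] w_sum[OF tx]
            eq[OF V] eq_V eq[OF Vn] eq_V0 W_eq p_bd])
        (auto simp: W_def)
  qed
  have E_terminal: "E N T x \<le> 2 * S\<^sup>2" if x: "x \<in> space_grid h" for N x
  proof -
    have "V T x = g x" "Vn n T x = g x" for n
      using V Vn[of n] x by (auto simp: solves_scheme_def)
    moreover have "(g x)\<^sup>2 \<le> S\<^sup>2" using power_mono[OF S_bd[of x], of 2] by simp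
    ultimately show ?thesis by (simp add: E_def W_def)
  qed
  have E_bd: "E N t x \<le> R" if tx: "(t, x) \<in> grid T \<tau> h" for N t x
  proof -
    have "E N t x \<le> exp (C1 / lam * T) * (2 * S\<^sup>2 + lam / 12 * T)"
    proof (rule backward_growth_bound[where a = w, OF \<tau>(1) h(1) _ _ _ \<tau>(3) _ w_sum E_step E_terminal tx])
      show "0 \<le> w t x i" if "(t, x) \<in> grid T \<tau> h" for t x i
        using w_lower[OF that, of i] Lam_lam by simp
    qed (use C1_0 Lam_lam in auto)
    then show ?thesis by (simp add: R_def algebra_simps)
  qed
  have R0: "0 \<le> R" using T Lam_lam by (simp add: R_def)
  \<comment> \<open>The sum in \<open>E\<close> starts at \<open>1\<close>. The bound for \<open>W 0 = Vn 0 - V\<close>, which the first policy update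
    needs, comes from the two squares in front of it and costs the factor \<open>2\<close>.\<close>
  have W_bd: "(W n t x)\<^sup>2 \<le> 2 * R / 2 ^ n" if tx: "(t, x) \<in> grid T \<tau> h" for n t x
  proof (cases n)
    case 0
    have "(W 0 t x)\<^sup>2 \<le> 2 * E 0 t x"
      using zero_le_power2[of "Vn 0 t x + V t x"]
      by (simp add: E_def W_def power2_eq_square algebra_simps)
    then show ?thesis using E_bd[OF tx, of 0] 0 by simp
  next
    case (Suc m)
    have "2 ^ n * (W n t x)\<^sup>2 \<le> (\<Sum>k=1..n. 2 ^ k * (W k t x)\<^sup>2)"
      using Suc by (intro member_le_sum) auto
    also have "\<dots> \<le> E n t x" by (simp add: E_def)
    also have "\<dots> \<le> 2 * R" using E_bd[OF tx, of n] R0 by linarith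
    finally show ?thesis by (simp add: field_simps)
  qed
  have RC: "6 * R \<le> Ch"
  proof -
    have "6 * (2 * S\<^sup>2 + T * lam / 12) \<le> 12 * S\<^sup>2 + T * lam" using T Lam_lam by simp
    then have "exp (C1 * T / lam) * (6 * (2 * S\<^sup>2 + T * lam / 12)) \<le> exp (C1 * T / lam) * (12 * S\<^sup>2 + T * lam)"
      by (intro mult_left_mono) auto
    then show ?thesis by (simp add: R_def Ch S_def mult.left_commute)
  qed
  have powi: "h powi (-2) * 2 powi (1 - int n) = 2 / (h\<^sup>2 * 2 ^ n)" for n
    using h by (simp add: power_int_diff power_int_minus field_simps)
  \<comment> \<open>No difference quotient is estimated by itself: the sup bound on \<open>W n\<close> is divided by \<open>h\<close>, which is
    the source of the factor \<open>h powi (-2)\<close>.\<close>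
  have diff_bd: "\<bar>fdiff h i (\<lambda>s y. Vn n s y - V s y) t x\<bar>\<^sup>2 \<le> Ch * h powi (-2) * 2 powi (1 - int n)"
    if tx: "(t, x) \<in> grid T \<tau> h" for n i t x
  proof -
    have t: "(t, x + h *\<^sub>R axis i 1) \<in> grid T \<tau> h"
      using tx space_grid_shift by (auto simp: grid_def)
    let ?u = "W n t (x + h *\<^sub>R axis i 1)" and ?v = "W n t x"
    have "(?u - ?v)\<^sup>2 \<le> 2 * ?u\<^sup>2 + 2 * ?v\<^sup>2"
      using zero_le_power2[of "?u + ?v"] by (simp add: power2_eq_square algebra_simps)
    also have "\<dots> \<le> 8 * R / 2 ^ n" using W_bd[OF tx, of n] W_bd[OF t, of n] by simp
    also have "\<dots> \<le> 2 * Ch / 2 ^ n" using RC R0 by (intro divide_right_mono) auto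
    finally have "(?u - ?v)\<^sup>2 / h\<^sup>2 \<le> 2 * Ch / 2 ^ n / h\<^sup>2" by (intro divide_right_mono) auto
    then show ?thesis
      unfolding mult.assoc powi by (simp add: fdiff_def W_def power_divide mult.commute)
  qed
  have gap_bd: "\<bar>Lag c f t x (dgrad h V t x) (\<alpha> n t x) (\<beta> n t x) - Ham A B c f t x (dgrad h V t x)\<bar>\<^sup>2
      \<le> 16 * d * Ch * F\<^sup>2 * h powi (-2) * 2 powi (1 - int n)"
    if tx: "(t, x) \<in> grid T \<tau> h" and n1: "1 \<le> n" for n t x
  proof -
    have x: "x \<in> space_grid h" and t: "t \<in> time_grid T \<tau>" using tx by (auto simp: grid_def)
    obtain m where n: "n = Suc m" using n1 by (cases n) auto
    have "\<bar>Lag c f t x (dgrad h V t x) (\<alpha> n t x) (\<beta> n t x) - Ham A B c f t x (dgrad h V t x)\<bar>\<^sup>2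
        \<le> (2 * F * norm (dgrad h (W m) t x))\<^sup>2"
      unfolding n by (intro power_mono gap tx) auto
    also have "\<dots> = 4 * F\<^sup>2 * (norm (dgrad h (W m) t x))\<^sup>2" by (simp add: power_mult_distrib)
    also have "\<dots> \<le> 4 * F\<^sup>2 * (d * (2 * R / 2 ^ m) / h\<^sup>2)"
      unfolding d_def using h t
      by (intro mult_left_mono norm_dgrad_le x W_bd) (auto simp: grid_def)
    also have "\<dots> = 16 * d * R * F\<^sup>2 / (h\<^sup>2 * 2 ^ n)" by (simp add: n mult_ac)
    also have "\<dots> \<le> 16 * d * (2 * Ch) * F\<^sup>2 / (h\<^sup>2 * 2 ^ n)"
      using RC R0 d1 by (intro divide_right_mono mult_right_mono mult_left_mono) auto
    finally show ?thesis unfolding mult.assoc powi by (simp add: mult_ac)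
  qed
  have grid_ne: "grid T \<tau> h \<noteq> ({} :: (real \<times> (real^'d)) set)"
  proof -
    have "0 \<in> time_grid T \<tau>" using T by (auto simp: time_grid_def intro!: exI[of _ 0])
    moreover have "(0 :: real^'d) \<in> space_grid h" by (auto simp: space_grid_def intro!: exI[of _ 0])
    ultimately show ?thesis by (auto simp: grid_def)
  qed
  have diffs: "bdd_above ((\<lambda>(t, x). \<bar>fdiff h i (\<lambda>s y. Vn n s y - V s y) t x\<bar>\<^sup>2) ` grid T \<tau> h) \<and>
     (SUP (t, x) \<in> grid T \<tau> h. \<bar>fdiff h i (\<lambda>s y. Vn n s y - V s y) t x\<bar>\<^sup>2)
       \<le> Ch * h powi (-2) * 2 powi (1 - int n)" for n i
    by (rule bdd_above_and_SUP_le[OF grid_ne]) (rule diff_bd)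
  have gaps: "bdd_above ((\<lambda>(t, x). \<bar>Lag c f t x (dgrad h V t x) (\<alpha> n t x) (\<beta> n t x)
                  - Ham A B c f t x (dgrad h V t x)\<bar>\<^sup>2) ` grid T \<tau> h) \<and>
     (SUP (t, x) \<in> grid T \<tau> h. \<bar>Lag c f t x (dgrad h V t x) (\<alpha> n t x) (\<beta> n t x)
                  - Ham A B c f t x (dgrad h V t x)\<bar>\<^sup>2)
       \<le> 16 * d * Ch * F\<^sup>2 * h powi (-2) * 2 powi (1 - int n)" if "1 \<le> n" for n
    by (rule bdd_above_and_SUP_le[OF grid_ne]) (rule gap_bd[OF _ that])
  show ?thesis
    unfolding F_def[unfolded D_def, symmetric] d_def[symmetric]
    by (intro allI impI conjI diffs[THEN conjunct1] diffs[THEN conjunct2]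
        gaps[THEN conjunct1] gaps[THEN conjunct2])
qed

end
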